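(* Let $\tilde{\mathcal{T}}$ be a regular two-dimensional simplex grid on $\overline\Omega$ with node set $\mathcal{N}(\tilde{\mathcal{T}})$, and let $\phi=(\phi^x,\phi^s):\overline\Omega\times[0,M]\to\mathbb{R}^2\times\mathbb{R}$ be piecewise linear in $x$-direction, that is, for each $s\in[0,M]$ the function $x\mapsto\phi(x,s)$ is continuous on $\overline\Omega$ and affine on each simplex $T\in\tilde{\mathcal{T}}$ (with $\phi^x(x,\cdot)$ integrable on $[0,M]$ for each $x$, so that the integrals below make sense). Let $\tau$ be a transportation cost. Then the condition $$\left|\int_{s_1}^{s_2}\phi^x(x,s)\,ds\right|\le\tau(|s_2-s_1|),\quad|\phi^x(x,s_1)|\le\tau'(0),\quad\text{and}\quad\phi^s(x,s_1)\ge0\qquad\forall s_1,s_2\in[0,M]$$ is satisfied for all $x\in\overline\Omega$ if and only if it is satisfied for all $x\in\mathcal{N}(\tilde{\mathcal{T}})$.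
   Context: $\Omega\subset\mathbb{R}^2$ is a bounded, open, convex domain and $M>0$. A transportation cost is a non-decreasing, concave, lower semi-continuous function $\tau:[0,\infty)\to[0,\infty)$ with $\tau(0)=0$; $\tau'(0)\in(0,\infty]$ denotes its right derivative at $0$ (if $\tau'(0)=\infty$ the corresponding constraint is void). A two-dimensional simplex is a triple $(x^0,x^1,x^2)$ of points (nodes) in $\mathbb{R}^2$ that are not collinear; it is identified with its convex hull. A two-dimensional simplicial grid on $\overline\Omega$ is a set of two-dimensional simplices with pairwise disjoint interiors and union $\overline\Omega$; its node set is the union of the nodes of all its simplices. The grid is regular if it has no hanging nodes, i.e. there is no node of the grid which lies in some simplex of the grid without being a node of that simplex. *)

theory Defs
  imports "HOL-Analysis.Analysis"
begin

definition lower_semicontinuous_on :: "real set \<Rightarrow> (real \<Rightarrow> real) \<Rightarrow> bool" where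
  "lower_semicontinuous_on S f \<longleftrightarrow>
     (\<forall>t\<in>S. \<forall>c. c < f t \<longrightarrow> eventually (\<lambda>u. c < f u) (at t within S))"

text \<open>Functions on the half line are total functions on the reals whose values at negative
  arguments are irrelevant.\<close>

definition transportation_cost :: "(real \<Rightarrow> real) \<Rightarrow> bool" where
  "transportation_cost \<tau> \<longleftrightarrow>
     (\<forall>t\<ge>0. 0 \<le> \<tau> t) \<and> mono_on {0..} \<tau> \<and> concave_on {0..} \<tau> \<and>
     lower_semicontinuous_on {0..} \<tau> \<and> \<tau> 0 = 0"

text \<open>The limit exists in the extended reals for every transportation cost, because the
  difference quotients of a concave function are monotone.\<close>

definition right_deriv0 :: "(real \<Rightarrow> real) \<Rightarrow> ereal" where
  "right_deriv0 \<tau> = Lim (at_right 0) (\<lambda>h. ereal ((\<tau> h - \<tau> 0) / h))"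

type_synonym triple2 = "(real^2) \<times> (real^2) \<times> (real^2)"

fun nodes :: "triple2 \<Rightarrow> (real^2) set" where
  "nodes (a, b, c) = {a, b, c}"

definition simplex2 :: "triple2 \<Rightarrow> bool" where
  "simplex2 T \<longleftrightarrow> \<not> collinear (nodes T)"

definition body :: "triple2 \<Rightarrow> (real^2) set" where
  "body T = convex hull (nodes T)"

text \<open>Two distinct triples with the same convex hull have intersecting interiors, so a grid
  contains only one ordering of the nodes of each of its simplices.\<close>

definition simplicial_grid :: "(real^2) set \<Rightarrow> triple2 set \<Rightarrow> bool" where
  "simplicial_grid D G \<longleftrightarrow>
     (\<forall>T\<in>G. simplex2 T) \<and>
     pairwise (\<lambda>S T. interior (body S) \<inter> interior (body T) = {}) G \<and>
     (\<Union>T\<in>G. body T) = D"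

definition grid_nodes :: "triple2 set \<Rightarrow> (real^2) set" where
  "grid_nodes G = (\<Union>T\<in>G. nodes T)"

definition regular_grid :: "triple2 set \<Rightarrow> bool" where
  "regular_grid G \<longleftrightarrow> \<not> (\<exists>n\<in>grid_nodes G. \<exists>T\<in>G. n \<in> body T \<and> n \<notin> nodes T)"

definition affine_map_on :: "'a::real_vector set \<Rightarrow> ('a \<Rightarrow> 'b::real_vector) \<Rightarrow> bool" where
  "affine_map_on S f \<longleftrightarrow> (\<exists>L c. linear L \<and> (\<forall>x\<in>S. f x = L x + c))"

text \<open>The components of \<open>\<phi>\<close> are \<open>\<phi>\<^sup>x = fst \<circ> \<phi>\<close> and \<open>\<phi>\<^sup>s = snd \<circ> \<phi>\<close>. The interval integral is
  oriented, so it also covers the case that \<open>s2 < s1\<close>.\<close>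

definition calibration_constraints ::
  "(real \<Rightarrow> real) \<Rightarrow> real \<Rightarrow> ((real^2) \<times> real \<Rightarrow> (real^2) \<times> real) \<Rightarrow> real^2 \<Rightarrow> bool" where
  "calibration_constraints \<tau> M \<phi> x \<longleftrightarrow>
     (\<forall>s1\<in>{0..M}. \<forall>s2\<in>{0..M}.
        norm (interval_lebesgue_integral lebesgue (ereal s1) (ereal s2) (\<lambda>s. fst (\<phi> (x, s))))
          \<le> \<tau> \<bar>s2 - s1\<bar> \<and>
        ereal (norm (fst (\<phi> (x, s1)))) \<le> right_deriv0 \<tau> \<and>
        snd (\<phi> (x, s1)) \<ge> 0)"

end

theory Submission
  imports Defs
begin

text \<open>For fixed \<open>s1\<close> and \<open>s2\<close>, each constraint says that an expression affine in \<open>x\<close> on a simplex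
  lies in a convex set, so the points of a simplex satisfying all of them form a convex set; if that
  set contains the nodes, it contains their convex hull.\<close>

lemma affine_map_on_convex_combination:
  assumes "affine_map_on S f" "convex S" "x \<in> S" "y \<in> S" "0 \<le> u" "0 \<le> v" "u + v = 1"
  shows "f (u *\<^sub>R x + v *\<^sub>R y) = u *\<^sub>R f x + v *\<^sub>R f y"
proof -
  obtain L c where "linear L" and f: "\<And>x. x \<in> S \<Longrightarrow> f x = L x + c"
    using assms(1) unfolding affine_map_on_def by blast
  have "u *\<^sub>R x + v *\<^sub>R y \<in> S"
    using assms(2-7) by (rule convexD)
  \<comment> \<open>The weights sum to 1, so the translation part splits in the same proportion as
    the linear part.\<close>
  moreover have "c = u *\<^sub>R c + v *\<^sub>R c"
    using assms(7) by (metis scaleR_add_left scaleR_one)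
  ultimately show ?thesis
    using assms(3,4) \<open>linear L\<close> by (simp add: f linear_add linear_scale algebra_simps)
qed

lemma norm_convex_combination_le:
  assumes "norm a \<le> B" "norm b \<le> B" "0 \<le> u" "0 \<le> v" "u + v = 1"
  shows "norm (u *\<^sub>R a + v *\<^sub>R b) \<le> B"
  using convexD[OF convex_cball, of a 0 B b u v] assms by simp

text \<open>The extended bound serves \<open>right_deriv0 \<tau>\<close>, which may be infinite. A
  finite \<open>B\<close> reduces to the real bound, an infinite one is trivial, and minus infinity
  contradicts the premises.\<close>

lemma ereal_norm_convex_combination_le:
  assumes "ereal (norm a) \<le> B" "ereal (norm b) \<le> B" "0 \<le> u" "0 \<le> v" "u + v = 1"
  shows "ereal (norm (u *\<^sub>R a + v *\<^sub>R b)) \<le> B"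
  using assms by (cases B) (auto intro: norm_convex_combination_le)

text \<open>Linearity of the oriented integral. The relation between \<open>h\<close>,
  \<open>f\<close> and \<open>g\<close> is asked for only on \<open>{0..M}\<close>, since \<phi> is
  controlled only for these parameters; this is enough because the range of integration stays
  inside.\<close>

lemma interval_lebesgue_integral_linear_combination:
  fixes f g h :: "real \<Rightarrow> 'b::euclidean_space"
  assumes "set_integrable lebesgue {0..M} f" "set_integrable lebesgue {0..M} g"
    and h: "\<And>s. s \<in> {0..M} \<Longrightarrow> h s = u *\<^sub>R f s + v *\<^sub>R g s"
    and "s1 \<in> {0..M}" "s2 \<in> {0..M}"
  shows "interval_lebesgue_integral lebesgue (ereal s1) (ereal s2) h =
    u *\<^sub>R interval_lebesgue_integral lebesgue (ereal s1) (ereal s2) f +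
    v *\<^sub>R interval_lebesgue_integral lebesgue (ereal s1) (ereal s2) g"
proof -
  \<comment> \<open>The oriented integral is a signed integral over the open interval between its
    endpoints. Leaving the order of \<open>a\<close> and \<open>b\<close> free lets one claim serve
    both orientations.\<close>
  have *: "set_lebesgue_integral lebesgue {a<..<b} h =
      u *\<^sub>R set_lebesgue_integral lebesgue {a<..<b} f + v *\<^sub>R set_lebesgue_integral lebesgue {a<..<b} g"
    if "a \<in> {0..M}" "b \<in> {0..M}" for a b
  proof -
    have sub: "{a<..<b} \<subseteq> {0..M}" using that by auto
    have "set_lebesgue_integral lebesgue {a<..<b} h =
        set_lebesgue_integral lebesgue {a<..<b} (\<lambda>s. u *\<^sub>R f s + v *\<^sub>R g s)"
      using sub h by (intro set_lebesgue_integral_cong) auto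
    also have "\<dots> = u *\<^sub>R set_lebesgue_integral lebesgue {a<..<b} f +
        v *\<^sub>R set_lebesgue_integral lebesgue {a<..<b} g"
      using set_integrable_subset[OF assms(1) _ sub] set_integrable_subset[OF assms(2) _ sub]
      by (subst set_integral_add) (auto intro: set_integrable_scaleR_right)
    finally show ?thesis .
  qed
  show ?thesis
    using assms(4,5) by (simp add: interval_lebesgue_integral_def * algebra_simps)
qed

text \<open>The set is cut down to \<open>S\<close> because a convex combination of points passes to
  the values of \<phi> only where \<phi> is affine. All three constraints survive such a
  combination: two are bounds on a norm, the third is a sign condition.\<close>

lemma convex_calibration_constraints:
  assumes "convex S"
    and affine: "\<And>s. s \<in> {0..M} \<Longrightarrow> affine_map_on S (\<lambda>x. \<phi> (x, s))"
    and integrable: "\<And>x. x \<in> S \<Longrightarrow> set_integrable lebesgue {0..M} (\<lambda>s. fst (\<phi> (x, s)))"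
  shows "convex {x \<in> S. calibration_constraints \<tau> M \<phi> x}"
proof (rule convexI)
  fix x y and u v :: real
  assume x: "x \<in> {x \<in> S. calibration_constraints \<tau> M \<phi> x}"
    and y: "y \<in> {x \<in> S. calibration_constraints \<tau> M \<phi> x}"
    and uv: "0 \<le> u" "0 \<le> v" "u + v = 1"
  have xy: "x \<in> S" "y \<in> S" using x y by auto
  define z where "z = u *\<^sub>R x + v *\<^sub>R y"
  have "z \<in> S"
    unfolding z_def using assms(1) xy uv by (rule convexD)
  \<comment> \<open>The affine map may change with \<open>s\<close>, but the weights
    \<open>u\<close> and \<open>v\<close> do not, so they can be pulled out of the integral over
    \<open>s\<close>.\<close>
  have z: "\<phi> (z, s) = u *\<^sub>R \<phi> (x, s) + v *\<^sub>R \<phi> (y, s)" if "s \<in> {0..M}" for s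
    using affine_map_on_convex_combination[OF affine[OF that] assms(1) xy uv] by (simp add: z_def)
  have "calibration_constraints \<tau> M \<phi> z"
    unfolding calibration_constraints_def
  proof (intro ballI conjI)
    fix s1 s2 assume s: "s1 \<in> {0..M}" "s2 \<in> {0..M}"
    have "interval_lebesgue_integral lebesgue (ereal s1) (ereal s2) (\<lambda>s. fst (\<phi> (z, s))) =
      u *\<^sub>R interval_lebesgue_integral lebesgue (ereal s1) (ereal s2) (\<lambda>s. fst (\<phi> (x, s))) +
      v *\<^sub>R interval_lebesgue_integral lebesgue (ereal s1) (ereal s2) (\<lambda>s. fst (\<phi> (y, s)))"
      by (rule interval_lebesgue_integral_linear_combination[OF integrable[OF xy(1)]
            integrable[OF xy(2)] _ s]) (simp add: z)
    then show "norm (interval_lebesgue_integral lebesgue (ereal s1) (ereal s2) (\<lambda>s. fst (\<phi> (z, s))))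
        \<le> \<tau> \<bar>s2 - s1\<bar>"
      using x y s uv by (auto simp: calibration_constraints_def intro!: norm_convex_combination_le)
    show "ereal (norm (fst (\<phi> (z, s1)))) \<le> right_deriv0 \<tau>"
      using x y s uv
      by (simp add: z calibration_constraints_def ereal_norm_convex_combination_le)
    show "snd (\<phi> (z, s1)) \<ge> 0"
      using x y s uv by (simp add: z calibration_constraints_def)
  qed
  with \<open>z \<in> S\<close> show "u *\<^sub>R x + v *\<^sub>R y \<in> {x \<in> S. calibration_constraints \<tau> M \<phi> x}"
    by (simp add: z_def)
qed

lemma nodes_subset_body: "nodes T \<subseteq> body T"
  unfolding body_def by (rule hull_subset)

theorem theorem3p2:
  fixes \<Omega> :: "(real^2) set"
    and M :: real
    and \<tau> :: "real \<Rightarrow> real"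
    and G :: "((real^2) \<times> (real^2) \<times> (real^2)) set"
    and \<phi> :: "(real^2) \<times> real \<Rightarrow> (real^2) \<times> real"
  assumes "bounded \<Omega>" and "open \<Omega>" and "convex \<Omega>" and "\<Omega> \<noteq> {}"
    and "M > 0"
    and "transportation_cost \<tau>"
    and "simplicial_grid (closure \<Omega>) G" and "regular_grid G"
    and "\<And>s. s \<in> {0..M} \<Longrightarrow> continuous_on (closure \<Omega>) (\<lambda>x. \<phi> (x, s))"
    and "\<And>s T. s \<in> {0..M} \<Longrightarrow> T \<in> G \<Longrightarrow> affine_map_on (body T) (\<lambda>x. \<phi> (x, s))"
    and "\<And>x. x \<in> closure \<Omega> \<Longrightarrow> set_integrable lebesgue {0..M} (\<lambda>s. fst (\<phi> (x, s)))"
  shows "(\<forall>x\<in>closure \<Omega>. calibration_constraints \<tau> M \<phi> x) \<longleftrightarrow>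
         (\<forall>x\<in>grid_nodes G. calibration_constraints \<tau> M \<phi> x)"
proof
  have D: "(\<Union>T\<in>G. body T) = closure \<Omega>"
    using assms(7) by (simp add: simplicial_grid_def)
  then have "grid_nodes G \<subseteq> closure \<Omega>"
    using nodes_subset_body unfolding grid_nodes_def by blast
  then show "\<forall>x\<in>grid_nodes G. calibration_constraints \<tau> M \<phi> x"
    if "\<forall>x\<in>closure \<Omega>. calibration_constraints \<tau> M \<phi> x"
    using that by blast
  show "\<forall>x\<in>closure \<Omega>. calibration_constraints \<tau> M \<phi> x"
    if N: "\<forall>x\<in>grid_nodes G. calibration_constraints \<tau> M \<phi> x"
  proof
    fix x assume "x \<in> closure \<Omega>"
    then obtain T where T: "T \<in> G" "x \<in> body T" using D by blast
    \<comment> \<open>Convexity is used one simplex at a time, since \<phi> is only piecewise affine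
      on the closure.\<close>
    have "convex {x \<in> body T. calibration_constraints \<tau> M \<phi> x}"
      using T D by (intro convex_calibration_constraints assms(10,11)) (auto simp: body_def)
    moreover have "nodes T \<subseteq> {x \<in> body T. calibration_constraints \<tau> M \<phi> x}"
      using nodes_subset_body N T unfolding grid_nodes_def by blast
    \<comment> \<open>\<open>body T\<close> is the smallest convex set containing the nodes of
      \<open>T\<close>.\<close>
    ultimately have "body T \<subseteq> {x \<in> body T. calibration_constraints \<tau> M \<phi> x}"
      using hull_minimal[of "nodes T" _ convex] by (simp add: body_def)
    then show "calibration_constraints \<tau> M \<phi> x" using T by blast
  qed
qed

end
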